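(* There is an online algorithm with competitive ratio at most $95$ for the submodular matroid secretary problem on transversal matroids. That is, for every bipartite graph $G=(L,R,E)$ and every non-negative, monotonically non-decreasing submodular $f':2^L\to\mathbb{R}_{\ge0}$, the algorithm accepts a set $\mathrm{ALG}\subseteq L$ that is independent in the transversal matroid of $G$ and satisfies $\mathbb{E}[f'(\mathrm{ALG})]\ge\frac{1}{95}\max\{f'(T): T \text{ independent}\}$.
   Context: Transversal matroid: for a bipartite graph $G=(L,R,E)$, the ground set is $L$ and $T\subseteq L$ is independent if there is a matching in $G$ whose set of left endpoints is exactly $T$. Online model: the right side $R$ is known in advance; the nodes of $L$ arrive one at a time in uniformly random order, and when $\ell\in L$ arrives its incident edges are revealed. An adversary fixes a non-negative, monotonically non-decreasing submodular $f'$ on subsets of $L$ ($f'(S)+f'(T)\ge f'(S\cup T)+f'(S\cap T)$), which the algorithm can query only on sets of already-arrived nodes. On arrival of a node the algorithm must immediately and irrevocably accept it or not, keeping the accepted set independent. Competitive ratio at most $C$ means $\mathbb{E}[f'(\mathrm{ALG})]\ge\frac1C$ times the optimum over independent sets, for every $f'$, expectation over the random order and internal randomness. *)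

theory Defs
  imports "HOL-Probability.Probability" "HOL-Combinatorics.Multiset_Permutations"
begin

definition bipartite :: "'l set \<Rightarrow> 'r set \<Rightarrow> ('l \<times> 'r) set \<Rightarrow> bool" where
  "bipartite L R E \<longleftrightarrow> finite L \<and> finite R \<and> E \<subseteq> L \<times> R"

definition nbrs :: "('l \<times> 'r) set \<Rightarrow> 'l \<Rightarrow> 'r set" where
  "nbrs E l = {r. (l, r) \<in> E}"

definition is_matching :: "('l \<times> 'r) set \<Rightarrow> ('l \<times> 'r) set \<Rightarrow> bool" where
  "is_matching E M \<longleftrightarrow> M \<subseteq> E \<and>
     (\<forall>e\<in>M. \<forall>e'\<in>M. e \<noteq> e' \<longrightarrow> fst e \<noteq> fst e' \<and> snd e \<noteq> snd e')"

definition transversal_indep :: "'l set \<Rightarrow> ('l \<times> 'r) set \<Rightarrow> 'l set \<Rightarrow> bool" where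
  "transversal_indep L E T \<longleftrightarrow> T \<subseteq> L \<and> (\<exists>M. is_matching E M \<and> fst ` M = T)"

definition nonneg_monotone_submodular :: "'l set \<Rightarrow> ('l set \<Rightarrow> real) \<Rightarrow> bool" where
  "nonneg_monotone_submodular L f \<longleftrightarrow>
     (\<forall>S. S \<subseteq> L \<longrightarrow> f S \<ge> 0) \<and>
     (\<forall>S T. S \<subseteq> T \<and> T \<subseteq> L \<longrightarrow> f S \<le> f T) \<and>
     (\<forall>S T. S \<subseteq> L \<and> T \<subseteq> L \<longrightarrow> f S + f T \<ge> f (S \<union> T) + f (S \<inter> T))"

text \<open>An online algorithm is modelled by a random seed distribution (a pmf on nat, the
  internal randomness) and a decision rule. When the k-th node arrives, the decision rule
  gets: the (known in advance) right side R, the number n = |L| of left nodes, the seed,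
  the list of arrived nodes so far (the current node last) each with its revealed
  neighbourhood, and a value oracle that answers only for sets of already-arrived nodes
  (other queries return 0). It returns True iff the current node is accepted.
  Previous decisions are determined by these data, so they need not be passed.\<close>
type_synonym ('l, 'r) decision_rule =
  "'r set \<Rightarrow> nat \<Rightarrow> nat \<Rightarrow> ('l \<times> 'r set) list \<Rightarrow> ('l set \<Rightarrow> real) \<Rightarrow> bool"

definition restrict_oracle :: "('l set \<Rightarrow> real) \<Rightarrow> 'l set \<Rightarrow> 'l set \<Rightarrow> real" where
  "restrict_oracle f A = (\<lambda>S. if S \<subseteq> A then f S else 0)"

definition run_alg ::
  "('l, 'r) decision_rule \<Rightarrow> 'l set \<Rightarrow> 'r set \<Rightarrow> ('l \<times> 'r) set \<Rightarrow> ('l set \<Rightarrow> real)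
     \<Rightarrow> 'l list \<Rightarrow> nat \<Rightarrow> 'l set" where
  "run_alg A L R E f xs \<omega> =
     {xs ! k | k. k < length xs \<and>
        A R (card L) \<omega> (map (\<lambda>l. (l, nbrs E l)) (take (Suc k) xs))
          (restrict_oracle f (set (take (Suc k) xs)))}"

definition opt_value :: "'l set \<Rightarrow> ('l \<times> 'r) set \<Rightarrow> ('l set \<Rightarrow> real) \<Rightarrow> real" where
  "opt_value L E f = Max (f ` {T. transversal_indep L E T})"

end

theory Submission
  imports Defs
begin

text \<open>
  Sample each node independently with probability \<open>p = 3/4\<close> (a prefix of binomial length) and
  run greedy on the sample \<open>H\<close>, matching the node of largest marginal value to a free neighbour.
  A later node is a candidate for the right node \<open>r\<close> if greedy on \<open>H\<close> plus this node would
  match it to \<open>r\<close>; the first candidate to arrive for each right node is accepted.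

  Run greedy on all of \<open>L\<close>, where a processed node enters the matching \<open>M\<close> if it is sampled and
  the candidate set \<open>N\<close> otherwise. The coin of a node is independent of its marginal \<open>w\<close> over \<open>M\<close>,
  hence \<open>p E[\<Sum>w] = E[f(M) - f({})]\<close>, and greedy gives \<open>f(OPT \<inter> H) - f({}) \<le> 2 (f(M) - f({}))\<close>.
  Let \<open>g \<le> w\<close> be the marginal over \<open>M \<union> N\<close>, so that \<open>\<Sum>g \<ge> f(M) - f({})\<close>. Since \<open>w\<close> decreases along
  greedy, the first nodes processed at each right node have total \<open>w\<close> at least \<open>f(M) - f({})\<close>.
  So their total \<open>g\<close> is at least \<open>2 (f(M) - f({})) - \<Sum>w\<close>, of expectation
  \<open>(2 - 1/p) E[f(M) - f({})]\<close>. With probability at least \<open>p (1 - p)\<close> such a first node is the only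
  candidate at its right node, and is then accepted. Altogether the algorithm gets at least a
  fraction \<open>p (1 - p) (2 p - 1) / 2 = 3/64\<close> of the optimum.
\<close>

section \<open>Independent sampling of a subset\<close>

text \<open>The expectation of \<open>\<phi> H\<close> when \<open>H\<close> contains each element
  of \<open>U\<close> independently with probability \<open>p\<close>. As an explicit finite sum it
  allows purely algebraic inductions over \<open>U\<close>.\<close>

definition sample_exp :: "real \<Rightarrow> 'a set \<Rightarrow> ('a set \<Rightarrow> real) \<Rightarrow> real" where
  "sample_exp p U \<phi> = (\<Sum>H\<in>Pow U. p ^ card H * (1 - p) ^ card (U - H) * \<phi> H)"

lemma sample_exp_cong:
  "(\<And>H. H \<subseteq> U \<Longrightarrow> \<phi> H = \<psi> H) \<Longrightarrow> sample_exp p U \<phi> = sample_exp p U \<psi>"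
  unfolding sample_exp_def by (rule sum.cong) auto

lemma sample_exp_mono:
  assumes "0 \<le> p" "p \<le> 1" "\<And>H. H \<subseteq> U \<Longrightarrow> \<phi> H \<le> \<psi> H"
  shows "sample_exp p U \<phi> \<le> sample_exp p U \<psi>"
  unfolding sample_exp_def using assms by (intro sum_mono mult_left_mono) auto

lemma sample_exp_add:
  "sample_exp p U (\<lambda>H. \<phi> H + \<psi> H) = sample_exp p U \<phi> + sample_exp p U \<psi>"
  unfolding sample_exp_def by (simp add: algebra_simps sum.distrib)

lemma sample_exp_diff:
  "sample_exp p U (\<lambda>H. \<phi> H - \<psi> H) = sample_exp p U \<phi> - sample_exp p U \<psi>"
  unfolding sample_exp_def by (simp add: algebra_simps sum_subtractf)

lemma sample_exp_cmult:
  "sample_exp p U (\<lambda>H. c * \<phi> H) = c * sample_exp p U \<phi>"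
  unfolding sample_exp_def by (simp add: sum_distrib_left mult_ac)

text \<open>Conditioning on the coin of \<open>x\<close>. In the form
  \<open>sample_exp_remove\<close> it drives the inductions along greedy.\<close>

lemma sample_exp_insert:
  assumes "finite U" "x \<notin> U"
  shows "sample_exp p (insert x U) \<phi> =
    p * sample_exp p U (\<lambda>H. \<phi> (insert x H)) + (1 - p) * sample_exp p U \<phi>"
proof -
  let ?t = "\<lambda>V H. p ^ card H * (1 - p) ^ card (V - H) * \<phi> H"
  have inj: "inj_on (insert x) (Pow U)"
    using assms by (intro inj_onI) (metis PowD insert_ident subsetD)
  have "sample_exp p (insert x U) \<phi> =
      (\<Sum>H\<in>Pow U. ?t (insert x U) H) + (\<Sum>H\<in>insert x ` Pow U. ?t (insert x U) H)"
    unfolding sample_exp_def Pow_insert using assms by (intro sum.union_disjoint) auto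
  also have "(\<Sum>H\<in>insert x ` Pow U. ?t (insert x U) H) =
      (\<Sum>H\<in>Pow U. ?t (insert x U) (insert x H))"
    by (simp add: sum.reindex[OF inj])
  also have "\<dots> = p * sample_exp p U (\<lambda>H. \<phi> (insert x H))"
    unfolding sample_exp_def sum_distrib_left
  proof (rule sum.cong[OF refl])
    fix H assume "H \<in> Pow U"
    then have "x \<notin> H" "finite H" and "insert x U - insert x H = U - H"
      using assms by (auto intro: finite_subset)
    then show "?t (insert x U) (insert x H) =
        p * (p ^ card H * (1 - p) ^ card (U - H) * \<phi> (insert x H))"
      by simp
  qed
  also have "(\<Sum>H\<in>Pow U. ?t (insert x U) H) = (1 - p) * sample_exp p U \<phi>"
    unfolding sample_exp_def sum_distrib_left
  proof (rule sum.cong[OF refl])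
    fix H assume "H \<in> Pow U"
    then have "insert x U - H = insert x (U - H)"
      using assms by auto
    then show "?t (insert x U) H = (1 - p) * (p ^ card H * (1 - p) ^ card (U - H) * \<phi> H)"
      using assms by simp
  qed
  finally show ?thesis by simp
qed

lemma sample_exp_remove:
  assumes "finite U" "x \<in> U"
  shows "sample_exp p U \<phi> =
    p * sample_exp p (U - {x}) (\<lambda>H. \<phi> (insert x H)) + (1 - p) * sample_exp p (U - {x}) \<phi>"
  using sample_exp_insert[of "U - {x}" x p \<phi>] assms by (simp add: insert_absorb)

lemma sample_exp_const: "finite U \<Longrightarrow> sample_exp p U (\<lambda>_. c) = c"
proof (induction U rule: finite_induct)
  case empty
  show ?case by (simp add: sample_exp_def)
next
  case (insert x U)
  then show ?case by (simp add: sample_exp_insert algebra_simps)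
qed

section \<open>Prefix sets of a uniformly random order\<close>

lemma card_permutations_with_prefix_set:
  assumes "finite L" "H \<subseteq> L"
  shows "card {xs \<in> permutations_of_set L. set (take (card H) xs) = H}
    = fact (card H) * fact (card L - card H)"
proof -
  have fin: "finite H" "finite (L - H)"
    using assms by (auto intro: finite_subset)
  let ?P = "permutations_of_set H \<times> permutations_of_set (L - H)"
  \<comment> \<open>A permutation with prefix set \<open>H\<close> is an ordering of
    \<open>H\<close> followed by an ordering of \<open>L - H\<close>.\<close>
  have "bij_betw (\<lambda>(ys, zs). ys @ zs) ?P
      {xs \<in> permutations_of_set L. set (take (card H) xs) = H}"
  proof (rule bij_betw_imageI)
    show "inj_on (\<lambda>(ys, zs). ys @ zs) ?P"
      by (auto simp: inj_on_def length_finite_permutations_of_set)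
    show "(\<lambda>(ys, zs). ys @ zs) ` ?P = {xs \<in> permutations_of_set L. set (take (card H) xs) = H}"
    proof (intro equalityI subsetI)
      fix xs assume "xs \<in> (\<lambda>(ys, zs). ys @ zs) ` ?P"
      then show "xs \<in> {xs \<in> permutations_of_set L. set (take (card H) xs) = H}"
        using assms by (auto simp: permutations_of_set_def distinct_card)
    next
      fix xs assume xs: "xs \<in> {xs \<in> permutations_of_set L. set (take (card H) xs) = H}"
      let ?y = "take (card H) xs" and ?z = "drop (card H) xs"
      have d: "distinct xs" "set xs = L" "set ?y = H"
        using xs by (auto simp: permutations_of_set_def)
      have "set ?y \<inter> set ?z = {}" "set ?y \<union> set ?z = L"
        using d(1,2) distinct_append[of ?y ?z] set_append[of ?y ?z] by auto
      then have "set ?z = L - H"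
        using d(3) by auto
      then have "(?y, ?z) \<in> ?P"
        using d by (auto simp: permutations_of_set_def)
      then show "xs \<in> (\<lambda>(ys, zs). ys @ zs) ` ?P"
        by (rule rev_image_eqI) simp
    qed
  qed
  then have "card {xs \<in> permutations_of_set L. set (take (card H) xs) = H} = card ?P"
    by (simp add: bij_betw_same_card)
  also have "\<dots> = fact (card H) * fact (card L - card H)"
    using fin assms by (simp add: card_cartesian_product card_Diff_subset)
  finally show ?thesis .
qed

lemma sum_permutations_prefix_set:
  fixes \<phi> :: "'a set \<Rightarrow> real"
  assumes "finite L" "k \<le> card L"
  shows "(\<Sum>xs\<in>permutations_of_set L. \<phi> (set (take k xs))) =
    fact k * fact (card L - k) * (\<Sum>H | H \<subseteq> L \<and> card H = k. \<phi> H)"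
proof -
  have "(\<Sum>xs\<in>permutations_of_set L. \<phi> (set (take k xs))) =
      (\<Sum>H | H \<subseteq> L \<and> card H = k.
        \<Sum>xs\<in>{xs \<in> permutations_of_set L. set (take k xs) = H}. \<phi> (set (take k xs)))"
  proof (rule sum.group[symmetric])
    show "finite (permutations_of_set L)" "finite {H. H \<subseteq> L \<and> card H = k}"
      using assms by auto
    show "(\<lambda>xs. set (take k xs)) ` permutations_of_set L \<subseteq> {H. H \<subseteq> L \<and> card H = k}"
    proof (rule image_subsetI)
      fix xs assume "xs \<in> permutations_of_set L"
      then have xs: "distinct xs" "set xs = L" "length xs = card L"
        by (auto simp: permutations_of_set_def distinct_card)
      then have "card (set (take k xs)) = k"
        using assms by (subst distinct_card) auto
      then show "set (take k xs) \<in> {H. H \<subseteq> L \<and> card H = k}"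
        using set_take_subset[of k xs] xs by auto
    qed
  qed
  also have "\<dots> = (\<Sum>H | H \<subseteq> L \<and> card H = k. fact k * fact (card L - k) * \<phi> H)"
  proof (rule sum.cong[OF refl])
    fix H assume "H \<in> {H. H \<subseteq> L \<and> card H = k}"
    then have H: "H \<subseteq> L" "card H = k" by auto
    have "(\<Sum>xs\<in>{xs \<in> permutations_of_set L. set (take k xs) = H}. \<phi> (set (take k xs))) =
        (\<Sum>xs\<in>{xs \<in> permutations_of_set L. set (take k xs) = H}. \<phi> H)"
      by (rule sum.cong) auto
    also have "\<dots> = fact k * fact (card L - k) * \<phi> H"
      using card_permutations_with_prefix_set[OF assms(1) H(1)] H(2) by simp
    finally show "(\<Sum>xs\<in>{xs \<in> permutations_of_set L. set (take k xs) = H}. \<phi> (set (take k xs))) =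
        fact k * fact (card L - k) * \<phi> H" .
  qed
  finally show ?thesis by (simp add: sum_distrib_left)
qed

text \<open>A prefix of binomial length of a uniformly random order contains each element
  independently with probability \<^term>\<open>p\<close>.\<close>

lemma expectation_binomial_prefix:
  fixes g :: "'a list \<times> nat \<Rightarrow> real"
  assumes "finite L" "0 \<le> p" "p \<le> 1"
    and le: "\<And>xs k. xs \<in> permutations_of_set L \<Longrightarrow> k \<le> card L \<Longrightarrow> \<phi> (set (take k xs)) \<le> g (xs, k)"
  shows "sample_exp p L \<phi> \<le> measure_pmf.expectation
    (pair_pmf (pmf_of_set (permutations_of_set L)) (binomial_pmf (card L) p)) g"
proof -
  let ?n = "card L" and ?P = "permutations_of_set L"
  let ?w = "\<lambda>k. real (?n choose k) * p ^ k * (1 - p) ^ (?n - k)"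
  have P: "finite ?P" "?P \<noteq> {}" "card ?P = fact ?n"
    using assms(1) by auto
  have "measure_pmf.expectation (pair_pmf (pmf_of_set ?P) (binomial_pmf ?n p)) g =
      (\<Sum>a\<in>?P \<times> {..?n}. g a * pmf (pair_pmf (pmf_of_set ?P) (binomial_pmf ?n p)) a)"
    using P assms by (intro integral_measure_pmf_real)
      (auto simp: set_pmf_binomial_eq split: if_splits)
  also have "\<dots> = (\<Sum>xs\<in>?P. \<Sum>k\<le>?n. g (xs, k) * (?w k / fact ?n))"
    unfolding sum.cartesian_product using P assms
    by (intro sum.cong) (auto simp: pmf_pair)
  also have "\<dots> \<ge> (\<Sum>xs\<in>?P. \<Sum>k\<le>?n. \<phi> (set (take k xs)) * (?w k / fact ?n))"
    using le assms by (intro sum_mono mult_right_mono) auto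
  also have "(\<Sum>xs\<in>?P. \<Sum>k\<le>?n. \<phi> (set (take k xs)) * (?w k / fact ?n)) =
      (\<Sum>k\<le>?n. (\<Sum>xs\<in>?P. \<phi> (set (take k xs))) * (?w k / fact ?n))"
    unfolding sum_distrib_right by (rule sum.swap)
  also have "\<dots> = (\<Sum>k\<le>?n. \<Sum>H | H \<subseteq> L \<and> card H = k. p ^ card H * (1 - p) ^ card (L - H) * \<phi> H)"
  proof (rule sum.cong[OF refl])
    fix k assume "k \<in> {..?n}"
    then have k: "k \<le> ?n" by simp
    \<comment> \<open>The factor k! (n - k)! / n! from the permutations cancels the binomial
      coefficient and leaves the weight of a single set \<open>H\<close>.\<close>
    have "(\<Sum>xs\<in>?P. \<phi> (set (take k xs))) * (?w k / fact ?n) =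
        (\<Sum>H | H \<subseteq> L \<and> card H = k. \<phi> H) * (p ^ k * (1 - p) ^ (?n - k))"
      using k by (simp add: sum_permutations_prefix_set[OF assms(1)] binomial_fact)
    also have "\<dots> = (\<Sum>H | H \<subseteq> L \<and> card H = k. p ^ card H * (1 - p) ^ card (L - H) * \<phi> H)"
      unfolding sum_distrib_right using assms(1)
      by (intro sum.cong) (auto simp: card_Diff_subset finite_subset)
    finally show "(\<Sum>xs\<in>?P. \<phi> (set (take k xs))) * (?w k / fact ?n) =
        (\<Sum>H | H \<subseteq> L \<and> card H = k. p ^ card H * (1 - p) ^ card (L - H) * \<phi> H)" .
  qed
  also have "\<dots> = (\<Sum>k\<in>{..?n}. \<Sum>H | H \<in> Pow L \<and> card H = k. p ^ card H * (1 - p) ^ card (L - H) * \<phi> H)"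
    by simp
  also have "\<dots> = sample_exp p L \<phi>"
    unfolding sample_exp_def using assms(1)
    by (intro sum.group) (auto intro: card_mono)
  finally show ?thesis .
qed

section \<open>Simulated greedy\<close>

definition tie_order :: "('a \<times> 'a) set" where
  "tie_order = (SOME r. well_order_on UNIV r)"

lemma tie_order: "well_order_on UNIV tie_order"
  unfolding tie_order_def by (rule someI_ex) (rule well_order_on)

definition maximizers :: "('a \<Rightarrow> real) \<Rightarrow> 'a set \<Rightarrow> 'a set" where
  "maximizers w C = {x \<in> C. \<forall>y\<in>C. w y \<le> w x}"

definition pick :: "('a \<Rightarrow> real) \<Rightarrow> 'a set \<Rightarrow> 'a" where
  "pick w C = (SOME x. x \<in> maximizers w C \<and> (\<forall>y\<in>maximizers w C. (x, y) \<in> tie_order))"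

lemma pick:
  assumes "finite C" "C \<noteq> {}"
  shows "pick w C \<in> maximizers w C" "\<forall>y\<in>maximizers w C. (pick w C, y) \<in> tie_order"
proof -
  have lin: "linear_order_on UNIV (tie_order :: ('a \<times> 'a) set)" and wf: "wf (tie_order - (Id :: ('a \<times> 'a) set))"
    using tie_order unfolding well_order_on_def by auto
  have "Max (w ` C) \<in> w ` C"
    using assms by auto
  then obtain a where "a \<in> C" "w a = Max (w ` C)"
    by auto
  then have "a \<in> maximizers w C"
    using assms by (auto simp: maximizers_def)
  then obtain z where z: "z \<in> maximizers w C"
    and "\<And>y. (y, z) \<in> tie_order - Id \<Longrightarrow> y \<notin> maximizers w C"
    using wfE_min[OF wf] by metis
  then have "\<forall>y\<in>maximizers w C. (z, y) \<in> tie_order"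
  proof (intro ballI)
    fix y assume "y \<in> maximizers w C"
    then have "(y, z) \<notin> tie_order - Id"
      using \<open>\<And>y. (y, z) \<in> tie_order - Id \<Longrightarrow> y \<notin> maximizers w C\<close> by blast
    moreover have "(z, y) \<in> tie_order \<or> (y, z) \<in> tie_order" if "z \<noteq> y"
      using lin that unfolding linear_order_on_def total_on_def by simp
    moreover have "(z, z) \<in> tie_order"
      using lin unfolding order_on_defs refl_on_def by simp
    ultimately show "(z, y) \<in> tie_order"
      by (cases "z = y") auto
  qed
  with z have "\<exists>x. x \<in> maximizers w C \<and> (\<forall>y\<in>maximizers w C. (x, y) \<in> tie_order)"
    by blast
  from someI_ex[OF this]
  show "pick w C \<in> maximizers w C" "\<forall>y\<in>maximizers w C. (pick w C, y) \<in> tie_order"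
    unfolding pick_def by auto
qed

text \<open>Discarding losing candidates does not change the winner. The fixed global order serves
  this purpose: an arbitrary choice from \<open>maximizers w C\<close> could change with
  \<open>C\<close>.\<close>

lemma pick_subset:
  assumes "finite C" "D \<subseteq> C" "C \<noteq> {}" "pick w C \<in> D"
  shows "pick w D = pick w C"
proof -
  have D: "finite D" "D \<noteq> {}"
    using assms finite_subset by auto
  note C = pick[OF assms(1,3), of w] and D = pick[OF D, of w]
  have "pick w C \<in> maximizers w D"
    using C(1) assms by (auto simp: maximizers_def)
  moreover have "pick w D \<in> maximizers w C"
    using calculation D(1) C(1) assms unfolding maximizers_def by fastforce
  ultimately have "(pick w C, pick w D) \<in> tie_order" "(pick w D, pick w C) \<in> tie_order"
    using C(2) D(2) by auto
  moreover have "antisym (tie_order :: ('a \<times> 'a) set)"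
    using tie_order by (auto simp: order_on_defs)
  ultimately show ?thesis
    by (auto dest: antisymD)
qed

section \<open>The greedy process and its invariances\<close>

definition cands :: "('l \<Rightarrow> 'r set) \<Rightarrow> 'r set \<Rightarrow> 'l set \<Rightarrow> 'l set" where
  "cands nb B U = {x \<in> U. \<not> nb x \<subseteq> B}"

text \<open>Greedy over the unprocessed nodes \<open>U\<close>, where \<open>A\<close> and \<open>B\<close> are the left and right nodes
  matched so far and \<open>H\<close> is the sample. A node outside \<open>H\<close> is recorded together with the
  right node it would get, but it leaves \<open>A\<close> and \<open>B\<close> unchanged.\<close>

function simulate :: "('l set \<Rightarrow> real) \<Rightarrow> ('l \<Rightarrow> 'r set) \<Rightarrow> 'l set \<Rightarrow> 'l set \<Rightarrow> 'r set \<Rightarrow> 'l set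
    \<Rightarrow> ('l \<times> 'r \<times> bool) list" where
  "simulate f nb H A B U =
    (if finite U \<and> cands nb B U \<noteq> {} then
      (let l = pick (\<lambda>x. f (insert x A)) (cands nb B U); r = (SOME r. r \<in> nb l - B)
       in (l, r, l \<in> H) #
         (if l \<in> H then simulate f nb H (insert l A) (insert r B) (U - {l})
          else simulate f nb H A B (U - {l})))
     else [])"
  by pat_completeness auto
termination
proof (relation "Wellfounded.measure (\<lambda>(f, nb, H, A, B, U). card U)", goal_cases)
  case 1
  show ?case by simp
next
  case (2 f nb H A B U l r)
  have "l \<in> U"
    using pick(1)[of "cands nb B U" "\<lambda>x. f (insert x A)"] 2 by (auto simp: cands_def maximizers_def)
  then show ?case using 2 card_Diff1_less[of U l] by simp
next
  case (3 f nb H A B U l r)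
  have "l \<in> U"
    using pick(1)[of "cands nb B U" "\<lambda>x. f (insert x A)"] 3 by (auto simp: cands_def maximizers_def)
  then show ?case using 3 card_Diff1_less[of U l] by simp
qed

declare simulate.simps [simp del]

lemma simulate_Nil [simp]: "cands nb B U = {} \<Longrightarrow> simulate f nb H A B U = []"
  by (simp add: simulate.simps)

text \<open>\<open>H\<close> is quantified after \<open>l\<close> and \<open>r\<close>: the next
  node and its right node do not depend on the sample, so the coin of \<open>l\<close> can be tossed
  after \<open>l\<close> has been chosen.\<close>

lemma simulate_Cons:
  assumes "finite U" "cands nb B U \<noteq> {}"
  obtains l r where "l \<in> cands nb B U" "l \<in> U" "r \<in> nb l" "r \<notin> B"
    "\<And>x. x \<in> cands nb B U \<Longrightarrow> f (insert x A) \<le> f (insert l A)"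
    "\<And>H. simulate f nb H A B U = (l, r, l \<in> H) #
       (if l \<in> H then simulate f nb H (insert l A) (insert r B) (U - {l})
        else simulate f nb H A B (U - {l}))"
proof -
  define l where "l = pick (\<lambda>x. f (insert x A)) (cands nb B U)"
  define r where "r = (SOME r. r \<in> nb l - B)"
  have "finite (cands nb B U)"
    using assms by (auto simp: cands_def)
  note P = pick(1)[OF this assms(2), of "\<lambda>x. f (insert x A)", folded l_def]
  have "l \<in> cands nb B U" "\<And>x. x \<in> cands nb B U \<Longrightarrow> f (insert x A) \<le> f (insert l A)"
    using P by (auto simp: maximizers_def)
  moreover have "l \<in> U" "\<exists>r. r \<in> nb l - B"
    using calculation(1) by (auto simp: cands_def)
  moreover have "r \<in> nb l - B"
    unfolding r_def using calculation(4) by (rule someI_ex)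
  moreover have "simulate f nb H A B U = (l, r, l \<in> H) #
       (if l \<in> H then simulate f nb H (insert l A) (insert r B) (U - {l})
        else simulate f nb H A B (U - {l}))" for H
    using assms by (subst simulate.simps) (simp add: Let_def l_def r_def)
  ultimately show ?thesis
    using that by blast
qed

lemma cands_antimono: "B \<subseteq> B' \<Longrightarrow> U' \<subseteq> U \<Longrightarrow> cands nb B' U' \<subseteq> cands nb B U"
  by (auto simp: cands_def)

text \<open>The run evaluates \<open>f\<close> only on subsets of \<open>A \<union> U\<close> and
  \<open>nb\<close> only on \<open>U\<close>, so data revealed online suffices to compute it. The
  sample may also change outside \<open>U\<close>.\<close>

lemma simulate_cong:
  assumes "finite U"
    and "\<And>S. S \<subseteq> A \<union> U \<Longrightarrow> f S = f' S"
    and "\<And>x. x \<in> U \<Longrightarrow> nb x = nb' x"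
    and "H \<inter> U = H' \<inter> U"
  shows "simulate f nb H A B U = simulate f' nb' H' A B U"
  using assms
proof (induction U arbitrary: A B rule: finite_psubset_induct)
  case (psubset U)
  have C: "cands nb B U = cands nb' B U"
    using psubset.prems(2) by (auto simp: cands_def)
  show ?case
  proof (cases "cands nb B U = {}")
    case True
    then show ?thesis using C by simp
  next
    case False
    have "maximizers (\<lambda>x. f (insert x A)) (cands nb B U) = maximizers (\<lambda>x. f' (insert x A)) (cands nb B U)"
    proof -
      have "f (insert x A) = f' (insert x A)" if "x \<in> cands nb B U" for x
        using that by (intro psubset.prems) (auto simp: cands_def)
      then show ?thesis unfolding maximizers_def by auto
    qed
    then have p: "pick (\<lambda>x. f (insert x A)) (cands nb B U) = pick (\<lambda>x. f' (insert x A)) (cands nb' B U)"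
      unfolding pick_def C by simp
    define l where "l = pick (\<lambda>x. f (insert x A)) (cands nb B U)"
    have "finite (cands nb B U)"
      using psubset.hyps by (auto simp: cands_def)
    from pick(1)[OF this False, of "\<lambda>x. f (insert x A)", folded l_def]
    have l: "l \<in> U"
      by (auto simp: maximizers_def cands_def)
    have nb: "nb l = nb' l" and H: "l \<in> H \<longleftrightarrow> l \<in> H'"
      using l psubset.prems by auto
    have IH: "simulate f nb H A' B' (U - {l}) = simulate f' nb' H' A' B' (U - {l})"
      if "A' \<subseteq> insert l A" for A' B'
    proof (rule psubset.IH)
      show "f S = f' S" if "S \<subseteq> A' \<union> (U - {l})" for S
        using that \<open>A' \<subseteq> insert l A\<close> l by (intro psubset.prems) auto
    qed (use l psubset.prems in auto)
    have "simulate f nb H A B U = (l, SOME r. r \<in> nb l - B, l \<in> H) #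
       (if l \<in> H then simulate f nb H (insert l A) (insert (SOME r. r \<in> nb l - B) B) (U - {l})
        else simulate f nb H A B (U - {l}))"
      using psubset.hyps False by (subst simulate.simps) (simp add: Let_def l_def)
    also have "\<dots> = (l, SOME r. r \<in> nb' l - B, l \<in> H') #
       (if l \<in> H' then simulate f' nb' H' (insert l A) (insert (SOME r. r \<in> nb' l - B) B) (U - {l})
        else simulate f' nb' H' A B (U - {l}))"
      using H nb IH[of A] IH[of "insert l A"] by auto
    also have "\<dots> = simulate f' nb' H' A B U"
      using psubset.hyps False C by (subst (3) simulate.simps) (simp add: Let_def l_def p[unfolded C])
    finally show ?thesis .
  qed
qed

text \<open>A processed node has left \<open>U\<close>, so its coin no longer affects the rest of
  the run.\<close>

lemma simulate_insert_sample:
  assumes "finite U" "l \<notin> U"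
  shows "simulate f nb (insert l H) A B U = simulate f nb H A B U"
  using assms by (intro simulate_cong) auto

lemma simulate_entry:
  assumes "finite U" "(l, r, h) \<in> set (simulate f nb H A B U)"
  shows "l \<in> U \<and> r \<in> nb l \<and> r \<notin> B \<and> (h \<longleftrightarrow> l \<in> H)"
  using assms
proof (induction U arbitrary: A B rule: finite_psubset_induct)
  case (psubset U)
  show ?case
  proof (cases "cands nb B U = {}")
    case True
    then show ?thesis using psubset by simp
  next
    case False
    from simulate_Cons[OF psubset.hyps False, of f A] obtain a b where
      ab: "a \<in> U" "b \<in> nb a" "b \<notin> B" "\<And>H. simulate f nb H A B U = (a, b, a \<in> H) #
       (if a \<in> H then simulate f nb H (insert a A) (insert b B) (U - {a})
        else simulate f nb H A B (U - {a}))"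
      by metis
    have "U - {a} \<subset> U" using ab by auto
    note IH = psubset.IH[OF this]
    show ?thesis
      using psubset.prems ab(1-3) IH unfolding ab(4) by (auto split: if_splits)
  qed
qed

lemma distinct_simulate:
  assumes "finite U"
  shows "distinct (map fst (simulate f nb H A B U))"
  using assms
proof (induction U arbitrary: A B rule: finite_psubset_induct)
  case (psubset U)
  show ?case
  proof (cases "cands nb B U = {}")
    case False
    from simulate_Cons[OF psubset.hyps False, of f A] obtain a b where
      ab: "a \<in> U" "\<And>H. simulate f nb H A B U = (a, b, a \<in> H) #
       (if a \<in> H then simulate f nb H (insert a A) (insert b B) (U - {a})
        else simulate f nb H A B (U - {a}))"
      by metis
    have "U - {a} \<subset> U" using ab by auto
    note IH = psubset.IH[OF this]
    have "(a, y) \<notin> set (simulate f nb H A' B' (U - {a}))" for y A' B'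
      using simulate_entry[of "U - {a}" a "fst y" "snd y"] psubset.hyps by auto
    then show ?thesis
      using IH unfolding ab(2) by auto
  qed simp
qed

text \<open>Unsampled nodes do not influence the rest of the simulation, so their fate can be
  decided online from the sample alone.\<close>

lemma simulate_restrict:
  assumes "finite U" "Y \<subseteq> U" "U \<inter> H \<subseteq> Y"
  shows "simulate f nb H A B Y = filter (\<lambda>e. fst e \<in> Y) (simulate f nb H A B U)"
  using assms
proof (induction U arbitrary: A B Y rule: finite_psubset_induct)
  case (psubset U)
  show ?case
  proof (cases "cands nb B U = {}")
    case True
    moreover have "cands nb B Y = {}"
      using True psubset.prems by (auto simp: cands_def)
    ultimately show ?thesis by simp
  next
    case False
    define l where "l = pick (\<lambda>x. f (insert x A)) (cands nb B U)"
    define r where "r = (SOME r. r \<in> nb l - B)"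
    have fin: "finite (cands nb B U)"
      using psubset.hyps by (auto simp: cands_def)
    from pick(1)[OF this False, of "\<lambda>x. f (insert x A)", folded l_def]
    have l: "l \<in> U" "l \<in> cands nb B U"
      by (auto simp: maximizers_def cands_def)
    have U: "simulate f nb H A B U = (l, r, l \<in> H) #
       (if l \<in> H then simulate f nb H (insert l A) (insert r B) (U - {l})
        else simulate f nb H A B (U - {l}))"
      using psubset.hyps False by (subst simulate.simps) (simp add: Let_def l_def r_def)
    show ?thesis
    proof (cases "l \<in> Y")
      case True
      have c: "l \<in> cands nb B Y" "cands nb B Y \<subseteq> cands nb B U"
        using l True psubset.prems by (auto simp: cands_def)
      have "finite Y" using psubset finite_subset by blast
      \<comment> \<open>\<open>l\<close> still wins in the smaller set, and its right node depends
        only on \<open>nb l - B\<close>, so both runs record the same entry.\<close>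
      moreover have "pick (\<lambda>x. f (insert x A)) (cands nb B Y) = l"
        unfolding l_def using pick_subset[OF fin c(2) False] c(1) by (simp add: l_def)
      ultimately have Y: "simulate f nb H A B Y = (l, r, l \<in> H) #
         (if l \<in> H then simulate f nb H (insert l A) (insert r B) (Y - {l})
          else simulate f nb H A B (Y - {l}))"
        using c by (subst simulate.simps) (auto simp: Let_def r_def)
      have IH: "simulate f nb H A' B' (Y - {l}) = filter (\<lambda>e. fst e \<in> Y) (simulate f nb H A' B' (U - {l}))"
        for A' B'
      proof -
        have "simulate f nb H A' B' (Y - {l}) =
            filter (\<lambda>e. fst e \<in> Y - {l}) (simulate f nb H A' B' (U - {l}))"
          using psubset.prems l by (intro psubset.IH[of "U - {l}" "Y - {l}"]) auto
        also have "\<dots> = filter (\<lambda>e. fst e \<in> Y) (simulate f nb H A' B' (U - {l}))"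
        proof (rule filter_cong[OF refl])
          fix e assume "e \<in> set (simulate f nb H A' B' (U - {l}))"
          then have "fst e \<in> U - {l}"
            using simulate_entry[of "U - {l}" "fst e" "fst (snd e)" "snd (snd e)" f nb H A' B']
              psubset.hyps by simp
          then show "fst e \<in> Y - {l} \<longleftrightarrow> fst e \<in> Y" by simp
        qed
        finally show ?thesis .
      qed
      show ?thesis
        using True unfolding U Y by (simp add: IH)
    next
      case False
      \<comment> \<open>Dropped nodes are unsampled, so this entry leaves \<open>A\<close> and
        \<open>B\<close> alone and the filter removes it.\<close>
      then have "l \<notin> H" using psubset.prems l by auto
      moreover have "simulate f nb H A B Y = filter (\<lambda>e. fst e \<in> Y) (simulate f nb H A B (U - {l}))"
        using psubset.prems l False by (intro psubset.IH[of "U - {l}" Y]) auto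
      ultimately show ?thesis
        using False unfolding U by simp
    qed
  qed
qed


section \<open>Value of the simulation\<close>

definition kept :: "('l \<times> 'r \<times> bool) list \<Rightarrow> 'l set" where
  "kept es = {l. \<exists>r. (l, r, True) \<in> set es}"

definition used :: "('l \<times> 'r \<times> bool) list \<Rightarrow> 'r set" where
  "used es = {r. \<exists>l. (l, r, True) \<in> set es}"

lemma kept_simps [simp]:
  "kept [] = {}" "kept ((l, r, h) # es) = (if h then insert l (kept es) else kept es)"
  by (auto simp: kept_def)

lemma used_simps [simp]:
  "used [] = {}" "used ((l, r, h) # es) = (if h then insert r (used es) else used es)"
  by (auto simp: used_def)

lemma kept_subset: "kept es \<subseteq> fst ` set es"
  unfolding kept_def by force

lemma fst_simulate:
  assumes "finite U"
  shows "fst ` set (simulate f nb H A B U) \<subseteq> U"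
proof (rule image_subsetI)
  fix e assume "e \<in> set (simulate f nb H A B U)"
  then show "fst e \<in> U"
    using simulate_entry[OF assms, of "fst e" "fst (snd e)" "snd (snd e)"] by simp
qed

lemma kept_simulate: "finite U \<Longrightarrow> kept (simulate f nb H A B U) \<subseteq> U"
  using kept_subset fst_simulate by (rule order.trans)

lemma finite_used: "finite (used es)"
proof (rule finite_subset)
  show "used es \<subseteq> (fst \<circ> snd) ` set es"
    unfolding used_def by force
qed simp

text \<open>In the following sums \<open>A\<close> is the set of kept nodes, \<open>X\<close> the set of all nodes recorded so far
  and \<open>S\<close> the set of their right nodes. Weights (\<open>w\<close>) are marginals over \<open>A\<close>, gains (\<open>g\<close>) are
  marginals over \<open>X\<close>; an entry is first if its right node has not been recorded before, and
  it is lonely if it is moreover the only unsampled entry at its right node.\<close>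

fun w_sum :: "('l set \<Rightarrow> real) \<Rightarrow> 'l set \<Rightarrow> ('l \<times> 'r \<times> bool) list \<Rightarrow> real" where
  "w_sum f A [] = 0"
| "w_sum f A ((l, r, h) # es) = f (insert l A) - f A + w_sum f (if h then insert l A else A) es"

fun w_first :: "('l set \<Rightarrow> real) \<Rightarrow> 'l set \<Rightarrow> 'r set \<Rightarrow> ('l \<times> 'r \<times> bool) list \<Rightarrow> real" where
  "w_first f A S [] = 0"
| "w_first f A S ((l, r, h) # es) = (if r \<in> S then 0 else f (insert l A) - f A)
    + w_first f (if h then insert l A else A) (insert r S) es"

fun g_first :: "('l set \<Rightarrow> real) \<Rightarrow> 'l set \<Rightarrow> 'r set \<Rightarrow> ('l \<times> 'r \<times> bool) list \<Rightarrow> real" where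
  "g_first f X S [] = 0"
| "g_first f X S ((l, r, h) # es) = (if r \<in> S then 0 else f (insert l X) - f X)
    + g_first f (insert l X) (insert r S) es"

fun g_lonely :: "('l set \<Rightarrow> real) \<Rightarrow> 'l set \<Rightarrow> 'r set \<Rightarrow> ('l \<times> 'r \<times> bool) list \<Rightarrow> real" where
  "g_lonely f X S [] = 0"
| "g_lonely f X S ((l, r, h) # es) =
    (if r \<notin> S \<and> \<not> h \<and> (\<forall>l'. (l', r, False) \<notin> set es) then f (insert l X) - f X else 0)
    + g_lonely f (insert l X) (insert r S) es"

locale submodular_secretary =
  fixes L :: "'l set" and f :: "'l set \<Rightarrow> real" and nb :: "'l \<Rightarrow> 'r set"
  assumes finite_L: "finite L" and nms: "nonneg_monotone_submodular L f"
begin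

section \<open>Submodularity and bounds along a single run\<close>

lemma f_nonneg: "S \<subseteq> L \<Longrightarrow> 0 \<le> f S"
  using nms by (auto simp: nonneg_monotone_submodular_def)

lemma f_mono: "S \<subseteq> T \<Longrightarrow> T \<subseteq> L \<Longrightarrow> f S \<le> f T"
  using nms by (auto simp: nonneg_monotone_submodular_def)

lemma f_submodular: "S \<subseteq> L \<Longrightarrow> T \<subseteq> L \<Longrightarrow> f (S \<union> T) + f (S \<inter> T) \<le> f S + f T"
  using nms by (auto simp: nonneg_monotone_submodular_def)

lemma diminishing:
  assumes "S \<subseteq> T" "T \<subseteq> L" "x \<in> L"
  shows "f (insert x T) - f T \<le> f (insert x S) - f S"
proof (cases "x \<in> T")
  case True
  then show ?thesis
    using assms f_mono[of S "insert x S"] by (auto simp: insert_absorb)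
next
  case False
  then have "insert x S \<union> T = insert x T" "insert x S \<inter> T = S"
    using assms by auto
  then show ?thesis
    using f_submodular[of "insert x S" T] assms by (simp add: order.trans[OF assms(1,2)])
qed

lemma f_union_le_sum:
  assumes "finite Q" "Q \<subseteq> L" "A \<subseteq> L"
  shows "f (A \<union> Q) \<le> f A + (\<Sum>t\<in>Q. f (insert t A) - f A)"
  using assms
proof (induction Q rule: finite_induct)
  case (insert t Q)
  then show ?case
    using diminishing[of A "A \<union> Q" t] by auto
qed simp

text \<open>Carrying the decided part \<open>A\<close> along makes the induction pass. With
  \<open>A = {}\<close> this bounds the expected value of the sampled part of
  \<open>T\<close>.\<close>

lemma sample_exp_submodular:
  assumes "finite U" "U \<subseteq> L" "A \<subseteq> L" "0 \<le> p" "p \<le> 1"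
  shows "p * f (T \<inter> (A \<union> U)) + (1 - p) * f (T \<inter> A) \<le> sample_exp p U (\<lambda>H. f (T \<inter> (A \<union> H)))"
  using assms
proof (induction U arbitrary: A rule: finite_induct)
  case empty
  then show ?case by (simp add: sample_exp_def algebra_simps)
next
  case (insert x U)
  have eq: "A \<union> insert x H = insert x A \<union> H" for H by auto
  let ?E = "\<lambda>A. sample_exp p U (\<lambda>H. f (T \<inter> (A \<union> H)))"
  have IH: "p * f (T \<inter> (B \<union> U)) + (1 - p) * f (T \<inter> B) \<le> ?E B" if "B \<in> {A, insert x A}" for B
    using insert that by (intro insert.IH) auto
  have "T \<inter> (insert x A \<union> U) = T \<inter> insert x A \<union> T \<inter> (A \<union> U)"
    by auto
  moreover have "f (T \<inter> A) \<le> f ((T \<inter> insert x A) \<inter> (T \<inter> (A \<union> U)))"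
    using insert.prems by (intro f_mono) auto
  moreover have "f (T \<inter> insert x A \<union> T \<inter> (A \<union> U)) + f ((T \<inter> insert x A) \<inter> (T \<inter> (A \<union> U)))
      \<le> f (T \<inter> insert x A) + f (T \<inter> (A \<union> U))"
    using insert.prems by (intro f_submodular) auto
  ultimately have "0 \<le> f (T \<inter> insert x A) + f (T \<inter> (A \<union> U)) - f (T \<inter> (insert x A \<union> U)) - f (T \<inter> A)"
    by simp
  then have "0 \<le> p * (1 - p) * (f (T \<inter> insert x A) + f (T \<inter> (A \<union> U))
      - f (T \<inter> (insert x A \<union> U)) - f (T \<inter> A))"
    using insert.prems by (intro mult_nonneg_nonneg) auto
  \<comment> \<open>The two sides differ exactly by the nonnegative quantity above.\<close>
  then have "p * f (T \<inter> (A \<union> insert x U)) + (1 - p) * f (T \<inter> A)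
      \<le> p * (p * f (T \<inter> (insert x A \<union> U)) + (1 - p) * f (T \<inter> insert x A))
        + (1 - p) * (p * f (T \<inter> (A \<union> U)) + (1 - p) * f (T \<inter> A))"
    unfolding eq by (simp add: algebra_simps)
  also have "\<dots> \<le> p * ?E (insert x A) + (1 - p) * ?E A"
    using IH[of A] IH[of "insert x A"] insert.prems by (intro add_mono mult_left_mono) simp_all
  also have "\<dots> = sample_exp p (insert x U) (\<lambda>H. f (T \<inter> (A \<union> H)))"
    using insert.hyps by (simp add: sample_exp_insert eq del: Un_insert_right)
  finally show ?case .
qed

text \<open>The gains of all entries telescope to the total increase of \<open>f\<close> over
  \<open>X\<close>. Since \<open>A \<subseteq> X\<close>, each gain is at most the weight, so the
  entries that are not first account for at most \<open>w_sum\<close> minus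
  \<open>w_first\<close>.\<close>

lemma g_first_bound:
  assumes "A \<subseteq> X" "X \<subseteq> L" "fst ` set es \<subseteq> L"
  shows "f (X \<union> fst ` set es) - f X - (w_sum f A es - w_first f A S es) \<le> g_first f X S es"
  using assms
proof (induction es arbitrary: A X S)
  case (Cons e es)
  obtain l r h where e: "e = (l, r, h)" by (cases e)
  have "f (insert l X \<union> fst ` set es) - f (insert l X)
      - (w_sum f (if h then insert l A else A) es - w_first f (if h then insert l A else A) (insert r S) es)
      \<le> g_first f (insert l X) (insert r S) es"
    using Cons.prems e by (intro Cons.IH) auto
  moreover have "f (insert l X) - f X \<le> f (insert l A) - f A"
    using Cons.prems e by (intro diminishing) auto
  ultimately show ?case
    unfolding e by simp
qed simp

text \<open>\<open>D\<close> stands for the accepted set. Marginals over \<open>D \<inter> X\<close>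
  are at least those over \<open>X\<close>, and they telescope; monotonicity covers the entries that
  are not lonely.\<close>

lemma g_lonely_le:
  assumes "X \<subseteq> L" "fst ` set es \<subseteq> L" "D \<subseteq> L"
    and "\<And>l r. (l, r, False) \<in> set es \<Longrightarrow> r \<notin> S \<Longrightarrow>
      (\<And>l'. (l', r, False) \<in> set es \<Longrightarrow> l' = l) \<Longrightarrow> l \<in> D"
  shows "g_lonely f X S es \<le> f (D \<inter> (X \<union> fst ` set es)) - f (D \<inter> X)"
  using assms
proof (induction es arbitrary: X S)
  case (Cons e es)
  obtain l r h where e: "e = (l, r, h)" by (cases e)
  have L: "insert l X \<subseteq> L"
    using Cons.prems(1,2) e by auto
  have IH: "g_lonely f (insert l X) (insert r S) es
      \<le> f (D \<inter> (insert l X \<union> fst ` set es)) - f (D \<inter> insert l X)"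
  proof (rule Cons.IH)
    fix l2 r2
    assume a: "(l2, r2, False) \<in> set es" "r2 \<notin> insert r S"
      "\<And>l'. (l', r2, False) \<in> set es \<Longrightarrow> l' = l2"
    show "l2 \<in> D"
    proof (rule Cons.prems(4))
      show "(l2, r2, False) \<in> set (e # es)" "r2 \<notin> S"
        using a(1,2) by auto
      \<comment> \<open>The head entry sits at \<open>r\<close>, which differs from
        \<open>r2\<close>, so it cannot compete there.\<close>
      show "l' = l2" if "(l', r2, False) \<in> set (e # es)" for l'
        using that a(2) a(3)[of l'] e by simp
    qed
  qed (use Cons.prems(1-3) e in auto)
  have eq: "X \<union> fst ` set (e # es) = insert l X \<union> fst ` set es"
    unfolding e by auto
  show ?case
  proof (cases "r \<notin> S \<and> \<not> h \<and> (\<forall>l'. (l', r, False) \<notin> set es)")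
    case True
    then have "l \<in> D"
      using Cons.prems(4)[of l r] unfolding e by auto
    then have "D \<inter> insert l X = insert l (D \<inter> X)" by auto
    then have "f (insert l X) - f X \<le> f (D \<inter> insert l X) - f (D \<inter> X)"
      using diminishing[of "D \<inter> X" X l] L by simp
    with True IH show ?thesis
      unfolding eq by (simp add: e)
  next
    case False
    have "f (D \<inter> X) \<le> f (D \<inter> insert l X)"
      using L by (intro f_mono) auto
    with False IH show ?thesis
      unfolding eq by (auto simp: e)
  qed
qed simp

text \<open>Weights decrease along the simulation, so the weight of the kept entry at a right node is
  at most the weight of the first entry there. For right nodes in \<open>S\<close>, whose first entry is
  already past, that weight is \<open>v\<close>.\<close>

lemma kept_le_w_first:
  assumes "finite U" "A \<subseteq> L" "U \<subseteq> L"
    and "\<And>r x. r \<in> S \<Longrightarrow> x \<in> cands nb B U \<Longrightarrow> f (insert x A) - f A \<le> v r"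
    and "\<And>r. r \<in> S \<Longrightarrow> 0 \<le> v r"
  shows "f (A \<union> kept (simulate f nb H A B U)) - f A
    \<le> w_first f A S (simulate f nb H A B U) + (\<Sum>r\<in>S \<inter> used (simulate f nb H A B U). v r)"
  using assms
proof (induction U arbitrary: A B S v rule: finite_psubset_induct)
  case (psubset U)
  show ?case
  proof (cases "cands nb B U = {}")
    case False
    from simulate_Cons[OF psubset.hyps False, of f A] obtain l r where
      lr: "l \<in> cands nb B U" "l \<in> U" "r \<in> nb l" "r \<notin> B"
      "\<And>x. x \<in> cands nb B U \<Longrightarrow> f (insert x A) \<le> f (insert l A)"
      and sim: "\<And>H. simulate f nb H A B U = (l, r, l \<in> H) #
       (if l \<in> H then simulate f nb H (insert l A) (insert r B) (U - {l})
        else simulate f nb H A B (U - {l}))"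
      by metis
    have sub: "U - {l} \<subset> U" and lL: "l \<in> L"
      using lr psubset.prems by auto
    let ?w = "f (insert l A) - f A"
    have w0: "0 \<le> ?w"
      using f_mono[of A "insert l A"] lL psubset.prems by auto
    \<comment> \<open>At its first entry \<open>r\<close> joins \<open>S\<close>, and the weight of
      that entry bounds everything later at \<open>r\<close>.\<close>
    define v' where "v' = (if r \<in> S then v else v(r := ?w))"
    define es where "es = (if l \<in> H then simulate f nb H (insert l A) (insert r B) (U - {l})
        else simulate f nb H A B (U - {l}))"
    define A' where "A' = (if l \<in> H then insert l A else A)"
    define B' where "B' = (if l \<in> H then insert r B else B)"
    have es: "es = simulate f nb H A' B' (U - {l})"
      by (simp add: es_def A'_def B'_def)
    have A': "A \<subseteq> A'" "A' \<subseteq> L"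
      using psubset.prems lL by (auto simp: A'_def)
    have IH: "f (A' \<union> kept es) - f A' \<le> w_first f A' (insert r S) es + (\<Sum>r\<in>insert r S \<inter> used es. v' r)"
      unfolding es
    proof (rule psubset.IH[OF sub A'(2)])
      show "U - {l} \<subseteq> L" using psubset.prems by auto
      show "0 \<le> v' s" if "s \<in> insert r S" for s
        using that psubset.prems(4) w0 by (auto simp: v'_def)
      show "f (insert x A') - f A' \<le> v' s" if s: "s \<in> insert r S" and "x \<in> cands nb B' (U - {l})" for s x
      proof -
        have x: "x \<in> cands nb B U"
          using that cands_antimono[of B B' "U - {l}" U] by (auto simp: B'_def split: if_splits)
        then have "x \<in> L"
          using psubset.prems by (auto simp: cands_def)
        then have "f (insert x A') - f A' \<le> f (insert x A) - f A"
          using A' by (intro diminishing) auto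
        also have "\<dots> \<le> v' s"
          using s x lr(5) psubset.prems(3) by (auto simp: v'_def)
        finally show ?thesis .
      qed
    qed
    have whole: "simulate f nb H A B U = (l, r, l \<in> H) # es"
      using sim es_def by simp
    show ?thesis
    proof (cases "l \<in> H")
      case True
      \<comment> \<open>The kept entry occupies \<open>r\<close>, so no later entry uses
        \<open>r\<close> and \<open>v' r\<close> never enters the sum.\<close>
      have "r \<notin> used es"
        using simulate_entry[of "U - {l}" _ r True f nb H A' B'] psubset.hyps True
        unfolding used_def es B'_def by auto
      then have "(\<Sum>r\<in>insert r S \<inter> used es. v' r) = (\<Sum>r\<in>S \<inter> used es. v r)"
        by (intro sum.cong) (auto simp: v'_def)
      moreover have "(\<Sum>s\<in>S \<inter> insert r (used es). v s) =
          (if r \<in> S then v r else 0) + (\<Sum>r\<in>S \<inter> used es. v r)"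
        using \<open>r \<notin> used es\<close> by (auto simp: finite_used)
      moreover have "r \<in> S \<Longrightarrow> ?w \<le> v r"
        using psubset.prems(3) lr(1) by auto
      ultimately show ?thesis
        using IH True unfolding whole by (simp add: A'_def split: if_splits)
    next
      case False
      \<comment> \<open>If \<open>r\<close> is new, the sum grows by at most \<open>?w\<close>,
        which \<open>w_first\<close> counts for this entry.\<close>
      have "(\<Sum>r\<in>insert r S \<inter> used es. v' r) \<le> (if r \<in> S then 0 else ?w) + (\<Sum>r\<in>S \<inter> used es. v r)"
      proof (cases "r \<in> S")
        case True
        then show ?thesis by (simp add: v'_def insert_absorb)
      next
        case rS: False
        have "(\<Sum>s\<in>insert r S \<inter> used es. v' s) \<le> (\<Sum>s\<in>insert r (S \<inter> used es). v' s)"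
          using rS w0 psubset.prems(4) by (intro sum_mono2) (auto simp: finite_used v'_def)
        also have "\<dots> = ?w + (\<Sum>s\<in>S \<inter> used es. v' s)"
          using rS by (simp add: finite_used v'_def)
        also have "(\<Sum>s\<in>S \<inter> used es. v' s) = (\<Sum>s\<in>S \<inter> used es. v s)"
          using rS by (intro sum.cong) (auto simp: v'_def)
        finally show ?thesis using rS by simp
      qed
      then show ?thesis
        using IH False unfolding whole by (simp add: A'_def)
    qed
  qed simp
qed

text \<open>A node of \<open>Q\<close> that greedy misses was blocked by a kept node of larger weight occupying
  its partner \<open>\<tau>\<close>, and a node that greedy keeps has no marginal value left.\<close>

lemma greedy_blocks:
  assumes "finite U" "A \<subseteq> L" "U \<subseteq> L" "Q \<subseteq> H \<inter> U" "inj_on \<tau> Q"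
    and "\<And>t. t \<in> Q \<Longrightarrow> \<tau> t \<in> nb t - B"
    and "M = A \<union> kept (simulate f nb H A B U)"
  shows "(\<Sum>t\<in>Q. f (insert t M) - f M) \<le> f M - f A"
  using assms
proof (induction U arbitrary: A B Q rule: finite_psubset_induct)
  case (psubset U)
  show ?case
  proof (cases "cands nb B U = {}")
    case True
    \<comment> \<open>No unprocessed node has a free neighbour, whereas every node of
      \<open>Q\<close> still has its partner free.\<close>
    then have "Q = {}"
      using psubset.prems(3,5) by (fastforce simp: cands_def)
    then show ?thesis
      using True psubset.prems by simp
  next
    case False
    from simulate_Cons[OF psubset.hyps False, of f A] obtain l r where
      lr: "l \<in> cands nb B U" "l \<in> U" "r \<in> nb l" "r \<notin> B"
      "\<And>x. x \<in> cands nb B U \<Longrightarrow> f (insert x A) \<le> f (insert l A)"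
      and sim: "\<And>H. simulate f nb H A B U = (l, r, l \<in> H) #
       (if l \<in> H then simulate f nb H (insert l A) (insert r B) (U - {l})
        else simulate f nb H A B (U - {l}))"
      by metis
    have sub: "U - {l} \<subset> U" and lL: "l \<in> L"
      using lr psubset.prems by auto
    have finQ: "finite Q"
      using psubset.hyps psubset.prems(3) by (auto intro: finite_subset)
    have M_L: "M \<subseteq> L"
      using psubset.prems(1,2,6) kept_simulate[OF psubset.hyps, of f nb H A B] by auto
    show ?thesis
    proof (cases "l \<in> H")
      case False
      then show ?thesis
        using psubset.prems by (intro psubset.IH[OF sub, of A Q B]) (auto simp: sim)
    next
      case True
      \<comment> \<open>The step removes \<open>l\<close> itself and, as \<open>\<tau>\<close> is
        injective, at most one other node, whose partner is \<open>r\<close>.\<close>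
      define Q' where "Q' = {t \<in> Q. t \<noteq> l \<and> \<tau> t \<noteq> r}"
      have M: "M = insert l A \<union> kept (simulate f nb H (insert l A) (insert r B) (U - {l}))"
        using psubset.prems(6) True by (simp add: sim)
      have IH: "(\<Sum>t\<in>Q'. f (insert t M) - f M) \<le> f M - f (insert l A)"
        using psubset.prems lL M
        by (intro psubset.IH[OF sub, of _ _ "insert r B"]) (auto simp: Q'_def intro: inj_on_subset)
      have zero: "f (insert l M) - f M = 0"
        using M by (simp add: insert_absorb)
      have "(\<Sum>t\<in>Q - Q'. f (insert t M) - f M) \<le> f (insert l A) - f A"
      proof (cases "\<exists>t\<in>Q. t \<noteq> l \<and> \<tau> t = r")
        case True
        then obtain t where t: "t \<in> Q" "t \<noteq> l" "\<tau> t = r" by blast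
        then have Q: "Q - Q' \<subseteq> {l, t}"
          using psubset.prems(4) by (auto simp: Q'_def inj_on_def)
        have tL: "t \<in> L" "t \<in> cands nb B U"
          using t(1) psubset.prems(2,3) psubset.prems(5)[OF t(1)] by (auto simp: cands_def)
        have "(\<Sum>t\<in>Q - Q'. f (insert t M) - f M) \<le> (\<Sum>t\<in>{l, t}. f (insert t M) - f M)"
        proof (rule sum_mono2)
          fix b assume "b \<in> {l, t} - (Q - Q')"
          then have "insert b M \<subseteq> L" using lL tL M_L by auto
          then show "0 \<le> f (insert b M) - f M"
            using f_mono[of M "insert b M"] by auto
        qed (use Q in auto)
        also have "\<dots> = f (insert t M) - f M"
          using t zero by simp
        also have "\<dots> \<le> f (insert t A) - f A"
          using tL M_L psubset.prems(6) by (intro diminishing) auto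
        also have "\<dots> \<le> f (insert l A) - f A"
          using lr(5) tL by simp
        finally show ?thesis .
      next
        case False
        then have "Q - Q' \<subseteq> {l}" by (auto simp: Q'_def)
        then have "(\<Sum>t\<in>Q - Q'. f (insert t M) - f M) = 0"
          using zero by (intro sum.neutral) auto
        then show ?thesis
          using f_mono[of A "insert l A"] lL psubset.prems by auto
      qed
      moreover have "(\<Sum>t\<in>Q. f (insert t M) - f M) =
          (\<Sum>t\<in>Q - Q'. f (insert t M) - f M) + (\<Sum>t\<in>Q'. f (insert t M) - f M)"
        by (intro sum.subset_diff finQ) (auto simp: Q'_def)
      ultimately show ?thesis using IH by simp
    qed
  qed
qed

text \<open>Adding \<open>T \<inter> H\<close> to the greedy set gains at most what greedy collected
  itself, by \<open>greedy_blocks\<close>; hence the factor 2.\<close>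

lemma greedy_approx:
  assumes "H \<subseteq> L" "T \<subseteq> L" "inj_on \<tau> T" "\<And>t. t \<in> T \<Longrightarrow> \<tau> t \<in> nb t"
  shows "f (T \<inter> H) - f {} \<le> 2 * (f (kept (simulate f nb H {} {} L)) - f {})"
proof -
  let ?M = "kept (simulate f nb H {} {} L)"
  have M_L: "?M \<subseteq> L"
    using kept_simulate[OF finite_L] .
  have fin: "finite (T \<inter> H)"
    using assms finite_L by (auto intro: finite_subset)
  have "f (T \<inter> H) \<le> f (?M \<union> (T \<inter> H))"
    using M_L assms by (intro f_mono) auto
  also have "\<dots> \<le> f ?M + (\<Sum>t\<in>T \<inter> H. f (insert t ?M) - f ?M)"
    using M_L assms fin by (intro f_union_le_sum) auto
  also have "(\<Sum>t\<in>T \<inter> H. f (insert t ?M) - f ?M) \<le> f ?M - f {}"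
    using assms finite_L
    by (intro greedy_blocks[where U = L and H = H and B = "{}" and \<tau> = \<tau>]) (auto intro: inj_on_subset)
  finally show ?thesis by simp
qed

section \<open>Expectations over the sample\<close>

text \<open>The coin of each recorded node is independent of its weight.\<close>

lemma sample_exp_w_sum:
  assumes "finite U"
  shows "p * sample_exp p U (\<lambda>H. w_sum f A (simulate f nb H A B U)) =
    sample_exp p U (\<lambda>H. f (A \<union> kept (simulate f nb H A B U)) - f A)"
  using assms
proof (induction U arbitrary: A B rule: finite_psubset_induct)
  case (psubset U)
  show ?case
  proof (cases "cands nb B U = {}")
    case True
    then show ?thesis
      using psubset.hyps by (simp add: sample_exp_const)
  next
    case False
    from simulate_Cons[OF psubset.hyps False, of f A] obtain l r where
      lr: "l \<in> U"
      and sim: "\<And>H. simulate f nb H A B U = (l, r, l \<in> H) #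
       (if l \<in> H then simulate f nb H (insert l A) (insert r B) (U - {l})
        else simulate f nb H A B (U - {l}))"
      by metis
    have sub: "U - {l} \<subset> U" and fin: "finite (U - {l})"
      using lr psubset.hyps by auto
    let ?w = "f (insert l A) - f A"
    let ?s1 = "\<lambda>H. simulate f nb H (insert l A) (insert r B) (U - {l})"
    let ?s0 = "\<lambda>H. simulate f nb H A B (U - {l})"
    note ins = simulate_insert_sample[OF fin, of l f nb, simplified]
    have 0: "sample_exp p (U - {l}) (\<lambda>H. \<phi> (simulate f nb H A B U)) =
        sample_exp p (U - {l}) (\<lambda>H. \<phi> ((l, r, False) # ?s0 H))" for \<phi>
      by (intro sample_exp_cong) (auto simp: sim)
    have 1: "sample_exp p (U - {l}) (\<lambda>H. \<phi> (simulate f nb (insert l H) A B U)) =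
        sample_exp p (U - {l}) (\<lambda>H. \<phi> ((l, r, True) # ?s1 H))" for \<phi>
      by (intro sample_exp_cong) (auto simp: sim ins)
    have "p * sample_exp p U (\<lambda>H. w_sum f A (simulate f nb H A B U)) =
        p * (?w + p * sample_exp p (U - {l}) (\<lambda>H. w_sum f (insert l A) (?s1 H))
          + (1 - p) * sample_exp p (U - {l}) (\<lambda>H. w_sum f A (?s0 H)))"
      unfolding sample_exp_remove[OF psubset.hyps lr] 0[of "w_sum f A"] 1[of "w_sum f A"]
      by (simp add: sample_exp_add sample_exp_const[OF fin] ring_distribs)
    also have "\<dots> = p * ?w + p * (p * sample_exp p (U - {l}) (\<lambda>H. w_sum f (insert l A) (?s1 H)))
          + (1 - p) * (p * sample_exp p (U - {l}) (\<lambda>H. w_sum f A (?s0 H)))"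
      by (simp add: algebra_simps)
    \<comment> \<open>The induction hypothesis handles both branches; \<open>p * ?w\<close> is what
      the coin of \<open>l\<close> itself contributes to the kept value.\<close>
    also have "\<dots> = p * ?w
        + p * sample_exp p (U - {l}) (\<lambda>H. f (insert l A \<union> kept (?s1 H)) - f (insert l A))
        + (1 - p) * sample_exp p (U - {l}) (\<lambda>H. f (A \<union> kept (?s0 H)) - f A)"
      by (simp only: psubset.IH[OF sub])
    also have "\<dots> = sample_exp p U (\<lambda>H. f (A \<union> kept (simulate f nb H A B U)) - f A)"
      unfolding sample_exp_remove[OF psubset.hyps lr]
        0[of "\<lambda>es. f (A \<union> kept es) - f A"] 1[of "\<lambda>es. f (A \<union> kept es) - f A"]
      by (simp add: sample_exp_diff sample_exp_const[OF fin] algebra_simps)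
    finally show ?thesis .
  qed
qed

text \<open>Consider the first entry at \<open>r\<close>: with probability \<open>p\<close> it is
  sampled, takes \<open>r\<close>, and no later entry sits there. If there is no entry at
  \<open>r\<close>, the event holds anyway.\<close>

lemma sample_exp_no_unsampled:
  assumes "finite U" "0 \<le> p" "p \<le> 1"
  shows "p \<le> sample_exp p U (\<lambda>H. of_bool (\<forall>l'. (l', r, False) \<notin> set (simulate f nb H A B U)))"
  using assms
proof (induction U arbitrary: A B rule: finite_psubset_induct)
  case (psubset U)
  show ?case
  proof (cases "cands nb B U = {}")
    case True
    then show ?thesis
      using psubset.hyps psubset.prems by (simp add: sample_exp_const)
  next
    case False
    from simulate_Cons[OF psubset.hyps False, of f A] obtain l s where
      lr: "l \<in> U"
      and sim: "\<And>H. simulate f nb H A B U = (l, s, l \<in> H) #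
       (if l \<in> H then simulate f nb H (insert l A) (insert s B) (U - {l})
        else simulate f nb H A B (U - {l}))"
      by metis
    have sub: "U - {l} \<subset> U" and fin: "finite (U - {l})"
      using lr psubset.hyps by auto
    let ?s1 = "\<lambda>H. simulate f nb H (insert l A) (insert s B) (U - {l})"
    let ?s0 = "\<lambda>H. simulate f nb H A B (U - {l})"
    let ?b = "\<lambda>es. of_bool (\<forall>l'. (l', r, False) \<notin> set es) :: real"
    note ins = simulate_insert_sample[OF fin, of l f nb, simplified]
    have 1: "sample_exp p (U - {l}) (\<lambda>H. ?b (simulate f nb (insert l H) A B U)) =
        sample_exp p (U - {l}) (\<lambda>H. ?b (?s1 H))"
      by (intro sample_exp_cong) (auto simp: sim ins)
    show ?thesis
    proof (cases "s = r")
      case True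
      have "sample_exp p (U - {l}) (\<lambda>H. ?b (?s1 H)) = sample_exp p (U - {l}) (\<lambda>H. 1)"
      proof (rule sample_exp_cong)
        fix H
        have "(l', r, False) \<notin> set (?s1 H)" for l'
          using simulate_entry[OF fin, of l' r False f nb H "insert l A" "insert s B"] True by auto
        then show "?b (?s1 H) = 1" by simp
      qed
      then have e1: "sample_exp p (U - {l}) (\<lambda>H. ?b (?s1 H)) = 1"
        by (simp only: sample_exp_const[OF fin])
      have "sample_exp p (U - {l}) (\<lambda>H. 0) \<le> sample_exp p (U - {l}) (\<lambda>H. ?b (simulate f nb H A B U))"
        using psubset.prems by (intro sample_exp_mono) auto
      then have "0 \<le> (1 - p) * sample_exp p (U - {l}) (\<lambda>H. ?b (simulate f nb H A B U))"
        using psubset.prems by (simp add: sample_exp_const[OF fin])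
      then show ?thesis
        unfolding sample_exp_remove[OF psubset.hyps lr] 1 e1 by simp
    next
      case False
      have 0: "sample_exp p (U - {l}) (\<lambda>H. ?b (simulate f nb H A B U)) =
          sample_exp p (U - {l}) (\<lambda>H. ?b (?s0 H))"
        using False by (intro sample_exp_cong) (auto simp: sim)
      have "p * p + (1 - p) * p \<le> p * sample_exp p (U - {l}) (\<lambda>H. ?b (?s1 H))
          + (1 - p) * sample_exp p (U - {l}) (\<lambda>H. ?b (?s0 H))"
        using psubset.prems by (intro add_mono mult_left_mono psubset.IH[OF sub]) auto
      then show ?thesis
        unfolding sample_exp_remove[OF psubset.hyps lr] 1 0 by (simp add: algebra_simps)
    qed
  qed
qed

text \<open>A first entry is unsampled with probability \<open>1 - p\<close>, and then with probability at least
  \<open>p\<close> the next entry at its right node, if any, is sampled and closes that node.\<close>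

lemma sample_exp_g_lonely:
  assumes "finite U" "U \<subseteq> L" "X \<subseteq> L" "0 \<le> p" "p \<le> 1"
  shows "p * (1 - p) * sample_exp p U (\<lambda>H. g_first f X S (simulate f nb H A B U))
    \<le> sample_exp p U (\<lambda>H. g_lonely f X S (simulate f nb H A B U))"
  using assms
proof (induction U arbitrary: A B X S rule: finite_psubset_induct)
  case (psubset U)
  show ?case
  proof (cases "cands nb B U = {}")
    case True
    then show ?thesis
      using psubset.hyps psubset.prems by (simp add: sample_exp_const)
  next
    case False
    from simulate_Cons[OF psubset.hyps False, of f A] obtain l r where
      lr: "l \<in> U"
      and sim: "\<And>H. simulate f nb H A B U = (l, r, l \<in> H) #
       (if l \<in> H then simulate f nb H (insert l A) (insert r B) (U - {l})
        else simulate f nb H A B (U - {l}))"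
      by metis
    have sub: "U - {l} \<subset> U" and fin: "finite (U - {l})"
      using lr psubset.hyps by auto
    \<comment> \<open>The gain credited to \<open>l\<close> is fixed before its coin is tossed, so
      it is the same in both branches of \<open>g_first\<close>.\<close>
    define c where "c = (if r \<in> S then 0 else f (insert l X) - f X)"
    have c: "0 \<le> c"
      using f_mono[of X "insert l X"] lr psubset.prems by (auto simp: c_def)
    let ?s1 = "\<lambda>H. simulate f nb H (insert l A) (insert r B) (U - {l})"
    let ?s0 = "\<lambda>H. simulate f nb H A B (U - {l})"
    let ?E = "sample_exp p (U - {l})"
    let ?g = "\<lambda>s. ?E (\<lambda>H. g_first f (insert l X) (insert r S) (s H))"
    let ?z = "\<lambda>s. ?E (\<lambda>H. g_lonely f (insert l X) (insert r S) (s H))"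
    let ?b = "\<lambda>es. of_bool (\<forall>l'. (l', r, False) \<notin> set es) :: real"
    note ins = simulate_insert_sample[OF fin, of l f nb, simplified]
    have g0: "?E (\<lambda>H. g_first f X S (simulate f nb H A B U)) =
        ?E (\<lambda>H. c + g_first f (insert l X) (insert r S) (?s0 H))"
      by (intro sample_exp_cong) (auto simp: sim c_def)
    have g1: "?E (\<lambda>H. g_first f X S (simulate f nb (insert l H) A B U)) =
        ?E (\<lambda>H. c + g_first f (insert l X) (insert r S) (?s1 H))"
      by (intro sample_exp_cong) (auto simp: sim ins c_def)
    have z0: "?E (\<lambda>H. g_lonely f X S (simulate f nb H A B U)) =
        ?E (\<lambda>H. c * ?b (?s0 H) + g_lonely f (insert l X) (insert r S) (?s0 H))"
      by (intro sample_exp_cong) (auto simp: sim c_def)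
    have z1: "?E (\<lambda>H. g_lonely f X S (simulate f nb (insert l H) A B U)) = ?z ?s1"
      by (intro sample_exp_cong) (auto simp: sim ins)
    have IH: "p * (1 - p) * ?g ?s1 \<le> ?z ?s1" "p * (1 - p) * ?g ?s0 \<le> ?z ?s0"
      using psubset.prems lr by (auto intro!: psubset.IH[OF sub])
    have cp: "c * p \<le> c * ?E (\<lambda>H. ?b (?s0 H))"
      using psubset.prems c by (intro mult_left_mono sample_exp_no_unsampled fin) auto
    have "p * (1 - p) * sample_exp p U (\<lambda>H. g_first f X S (simulate f nb H A B U)) =
        p * (p * (1 - p) * ?g ?s1) + (1 - p) * (c * p + p * (1 - p) * ?g ?s0)"
      unfolding sample_exp_remove[OF psubset.hyps lr] g0 g1
      by (simp add: sample_exp_add sample_exp_const[OF fin] algebra_simps)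
    also have "\<dots> \<le> p * ?z ?s1 + (1 - p) * (c * ?E (\<lambda>H. ?b (?s0 H)) + ?z ?s0)"
      using psubset.prems IH add_mono[OF cp IH(2)]
      by (intro add_mono[of "p * _" "p * _"] mult_left_mono) auto
    also have "\<dots> = sample_exp p U (\<lambda>H. g_lonely f X S (simulate f nb H A B U))"
      unfolding sample_exp_remove[OF psubset.hyps lr] z0 z1
      by (simp only: sample_exp_add sample_exp_cmult)
    finally show ?thesis .
  qed
qed

text \<open>Chains the greedy guarantee, the coin identity and the loneliness bound.
  \<open>1 / 2 \<le> p\<close> makes \<open>2 * p - 1\<close> nonnegative, so the lower bound on the
  greedy value can be multiplied by it.\<close>

lemma sample_exp_g_lonely_ge:
  assumes p: "1 / 2 \<le> p" "p \<le> 1"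
    and T: "T \<subseteq> L" "inj_on \<tau> T" "\<And>t. t \<in> T \<Longrightarrow> \<tau> t \<in> nb t"
  shows "p * (1 - p) * (2 * p - 1) / 2 * (f T - f {})
    \<le> sample_exp p L (\<lambda>H. g_lonely f {} {} (simulate f nb H {} {} L))"
proof -
  let ?s = "\<lambda>H. simulate f nb H {} {} L"
  let ?K = "sample_exp p L (\<lambda>H. f (kept (?s H)) - f {})"
  let ?W = "sample_exp p L (\<lambda>H. w_sum f {} (?s H))"
  have p0: "0 < p" using p by simp
  have "p * f (T \<inter> ({} \<union> L)) + (1 - p) * f (T \<inter> {}) \<le> sample_exp p L (\<lambda>H. f (T \<inter> ({} \<union> H)))"
    using p finite_L by (intro sample_exp_submodular) auto
  then have "p * (f T - f {}) \<le> sample_exp p L (\<lambda>H. f (T \<inter> H) - f {})"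
    using T by (simp add: Int_absorb2 sample_exp_diff sample_exp_const finite_L algebra_simps)
  also have "\<dots> \<le> sample_exp p L (\<lambda>H. 2 * (f (kept (?s H)) - f {}))"
    using p T by (intro sample_exp_mono greedy_approx) auto
  finally have K: "p * (f T - f {}) / 2 \<le> ?K"
    unfolding sample_exp_cmult by simp
  have W: "p * ?W = ?K"
    using sample_exp_w_sum[OF finite_L, of p "{}" "{}"] by simp
  \<comment> \<open>One copy of the kept value comes from the total increase along the run, the
    other from the first entries.\<close>
  have "2 * (f (kept (?s H)) - f {}) - w_sum f {} (?s H) \<le> g_first f {} {} (?s H)" for H
  proof -
    have sub: "fst ` set (?s H) \<subseteq> L"
      by (rule fst_simulate[OF finite_L])
    have "f (kept (?s H)) - f {} \<le> w_first f {} {} (?s H)"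
      \<comment> \<open>\<open>S\<close> starts empty, so any function serves as
        \<open>v\<close>.\<close>
      using kept_le_w_first[of L "{}" "{}" "{}" undefined H] finite_L by simp
    moreover have "f (kept (?s H)) \<le> f (fst ` set (?s H))"
      using sub by (intro f_mono kept_subset)
    ultimately show ?thesis
      using g_first_bound[of "{}" "{}" "?s H" "{}"] sub by simp
  qed
  then have "2 * ?K - ?W \<le> sample_exp p L (\<lambda>H. g_first f {} {} (?s H))"
    using p by (simp only: sample_exp_diff[symmetric] sample_exp_cmult[symmetric]) (intro sample_exp_mono; simp)
  then have "p * (1 - p) * (2 * ?K - ?W) \<le> p * (1 - p) * sample_exp p L (\<lambda>H. g_first f {} {} (?s H))"
    using p by (intro mult_left_mono) auto
  also have "\<dots> \<le> sample_exp p L (\<lambda>H. g_lonely f {} {} (?s H))"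
    using p finite_L by (intro sample_exp_g_lonely) auto
  also have "p * (1 - p) * (2 * ?K - ?W) = (1 - p) * (2 * p * ?K - p * ?W)"
    by (simp add: algebra_simps)
  also have "\<dots> = (1 - p) * (2 * p - 1) * ?K"
    unfolding W by (simp add: algebra_simps)
  finally have "(1 - p) * (2 * p - 1) * ?K \<le> sample_exp p L (\<lambda>H. g_lonely f {} {} (?s H))" .
  moreover have "(1 - p) * (2 * p - 1) * (p * (f T - f {}) / 2) \<le> (1 - p) * (2 * p - 1) * ?K"
    using K p by (intro mult_left_mono) auto
  ultimately have "(1 - p) * (2 * p - 1) * (p * (f T - f {}) / 2)
      \<le> sample_exp p L (\<lambda>H. g_lonely f {} {} (?s H))"
    by (rule order.trans[rotated])
  then show ?thesis by (simp add: mult_ac)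
qed

end

section \<open>The algorithm\<close>

text \<open>Running greedy on the sample and \<open>l\<close> alone is possible as soon as
  \<open>l\<close> arrives. \<open>None\<close> means that all neighbours of \<open>l\<close> get
  taken before greedy reaches \<open>l\<close>.\<close>

definition label :: "('l set \<Rightarrow> real) \<Rightarrow> ('l \<Rightarrow> 'r set) \<Rightarrow> 'l set \<Rightarrow> 'l \<Rightarrow> ('r \<times> bool) option" where
  "label f nb H l = map_of (simulate f nb H {} {} (insert l H)) l"

text \<open>The seed \<open>k\<close> is the length of the sampling phase, during which
  \<open>post\<close> is empty. Later nodes lie outside the sample and have flag
  \<open>False\<close>, so equal labels mean equal right nodes.\<close>

definition sampling_rule :: "('l, 'r) decision_rule" where
  "sampling_rule R n k hist orc =
    (let nb = (\<lambda>l. the (map_of hist l)); H = set (map fst (take k hist));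
         post = map fst (drop k hist); lab = label orc nb H
     in post \<noteq> [] \<and> lab (last post) \<noteq> None \<and>
        (\<forall>y\<in>set (butlast post). lab y \<noteq> lab (last post)))"

text \<open>By \<open>simulate_restrict\<close>, all labels can be read off one run over
  \<open>L\<close>, which allows an offline analysis of the online rule.\<close>

lemma label_eq:
  assumes "finite L" "H \<subseteq> L" "l \<in> L"
  shows "label f nb H l = map_of (simulate f nb H {} {} L) l"
proof -
  have "simulate f nb H {} {} (insert l H) =
      filter (\<lambda>e. fst e \<in> insert l H) (simulate f nb H {} {} L)"
    using assms by (intro simulate_restrict) auto
  moreover have "map_of (filter (\<lambda>e. fst e \<in> insert l H) es) l = map_of es l" for es :: "('a \<times> 'b \<times> bool) list"
    by (induction es) auto
  ultimately show ?thesis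
    by (simp add: label_def)
qed

text \<open>Labels involve arrived nodes only, so the history and the restricted oracle can be
  replaced by \<open>E\<close> and \<open>f\<close>.\<close>

lemma run_alg_sampling_rule:
  fixes f :: "'l set \<Rightarrow> real" and E :: "('l \<times> 'r) set" and xs :: "'l list"
  defines "lab \<equiv> \<lambda>k. label f (nbrs E) (set (take k xs))"
  shows "run_alg sampling_rule L R E f xs k =
    {xs ! j | j. k \<le> j \<and> j < length xs \<and> lab k (xs ! j) \<noteq> None \<and>
       (\<forall>i. k \<le> i \<and> i < j \<longrightarrow> lab k (xs ! i) \<noteq> lab k (xs ! j))}"
proof -
  have "sampling_rule R (card L) k (map (\<lambda>l. (l, nbrs E l)) (take (Suc j) xs))
        (restrict_oracle f (set (take (Suc j) xs))) \<longleftrightarrow>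
      k \<le> j \<and> lab k (xs ! j) \<noteq> None \<and>
       (\<forall>i. k \<le> i \<and> i < j \<longrightarrow> lab k (xs ! i) \<noteq> lab k (xs ! j))"
    if j: "j < length xs" for j
  proof -
    define hist where "hist = map (\<lambda>l. (l, nbrs E l)) (take (Suc j) xs)"
    define orc where "orc = restrict_oracle f (set (take (Suc j) xs))"
    have post: "map fst (drop k hist) = drop k (take (Suc j) xs)"
      by (simp add: hist_def drop_map comp_def)
    show ?thesis
    proof (cases "k \<le> j")
      case False
      then show ?thesis
        by (simp add: sampling_rule_def hist_def)
    next
      case True
      have H: "set (map fst (take k hist)) = set (take k xs)"
        using True by (simp add: hist_def take_map comp_def min_def)
      have post': "drop k (take (Suc j) xs) = drop k (take j xs) @ [xs ! j]"
        using True j by (simp add: take_Suc_conv_app_nth)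
      have nth: "set (drop k (take j xs)) = {xs ! i | i. k \<le> i \<and> i < j}"
      proof (intro equalityI subsetI)
        fix y assume "y \<in> set (drop k (take j xs))"
        then obtain i where "i < j - k" "y = xs ! (k + i)"
          using j True by (auto simp: in_set_conv_nth)
        then show "y \<in> {xs ! i | i. k \<le> i \<and> i < j}"
          by (auto intro!: exI[of _ "k + i"])
      next
        fix y assume "y \<in> {xs ! i | i. k \<le> i \<and> i < j}"
        then obtain i where "k \<le> i" "i < j" "y = xs ! i" by auto
        then show "y \<in> set (drop k (take j xs))"
          using j by (auto simp: in_set_conv_nth intro!: exI[of _ "i - k"])
      qed
      have lab: "label orc (\<lambda>l. the (map_of hist l)) (set (take k xs)) y = lab k y"
        if "y \<in> set (take (Suc j) xs)" for y
      proof -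
        have sub: "insert y (set (take k xs)) \<subseteq> set (take (Suc j) xs)"
          using that True set_take_subset_set_take[of k "Suc j" xs] by auto
        have "simulate orc (\<lambda>l. the (map_of hist l)) (set (take k xs)) {} {} (insert y (set (take k xs)))
          = simulate f (nbrs E) (set (take k xs)) {} {} (insert y (set (take k xs)))"
        proof (rule simulate_cong)
          show "orc S = f S" if "S \<subseteq> {} \<union> insert y (set (take k xs))" for S
            using that sub by (auto simp: orc_def restrict_oracle_def)
          show "the (map_of hist x) = nbrs E x" if "x \<in> insert y (set (take k xs))" for x
            using that sub map_of_map_restrict[of "nbrs E" "take (Suc j) xs"]
            by (auto simp: hist_def restrict_map_def)
        qed auto
        then show ?thesis
          by (simp add: label_def lab_def)
      qed
      have mem: "xs ! i \<in> set (take (Suc j) xs)" if "i \<le> j" for i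
        using that j by (auto simp: in_set_conv_nth intro!: exI[of _ i])
      have "sampling_rule R (card L) k hist orc \<longleftrightarrow> lab k (xs ! j) \<noteq> None \<and>
          (\<forall>y\<in>set (drop k (take j xs)). lab k y \<noteq> lab k (xs ! j))"
      proof -
        have "y \<in> set (take (Suc j) xs)" if "y \<in> set (drop k (take j xs))" for y
          using that mem unfolding nth by auto
        then show ?thesis
          unfolding sampling_rule_def Let_def H post post' by (simp add: lab mem)
      qed
      then show ?thesis
        using True unfolding nth hist_def[symmetric] orc_def[symmetric] by auto
    qed
  qed
  then show ?thesis
    unfolding run_alg_def by blast
qed

text \<open>Accepted nodes carry distinct labels with flag \<open>False\<close>, hence distinct
  right nodes; these form the matching.\<close>

lemma sampling_rule_independent:
  assumes G: "bipartite L R E" and xs: "xs \<in> permutations_of_set L"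
  shows "transversal_indep L E (run_alg sampling_rule L R E f xs k)"
proof -
  define H where "H = set (take k xs)"
  define lab where "lab = label f (nbrs E) H"
  let ?D = "run_alg sampling_rule L R E f xs k"
  have L: "finite L" and x: "distinct xs" "set xs = L"
    using G xs by (auto simp: bipartite_def permutations_of_set_def)
  have HL: "H \<subseteq> L"
    using x set_take_subset[of k xs] by (simp add: H_def)
  have D: "?D = {xs ! j | j. k \<le> j \<and> j < length xs \<and> lab (xs ! j) \<noteq> None \<and>
       (\<forall>i. k \<le> i \<and> i < j \<longrightarrow> lab (xs ! i) \<noteq> lab (xs ! j))}"
    unfolding run_alg_sampling_rule lab_def H_def ..
  have lab: "r \<in> nbrs E l \<and> \<not> h" if "lab l = Some (r, h)" "l \<in> L - H" for l r h
  proof -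
    have "(l, r, h) \<in> set (simulate f (nbrs E) H {} {} L)"
      using that label_eq[OF L HL, of l f "nbrs E"] by (intro map_of_SomeD) (auto simp: lab_def)
    then show ?thesis
      using simulate_entry[OF L, of l r h f "nbrs E" H] that by auto
  qed
  have DLH: "?D \<subseteq> L - H"
  proof
    fix y assume "y \<in> ?D"
    then obtain j where j: "y = xs ! j" "k \<le> j" "j < length xs"
      unfolding D by auto
    have "xs ! j \<notin> H"
      using j x(1) by (auto simp: H_def in_set_conv_nth nth_eq_iff_index_eq)
    then show "y \<in> L - H"
      using j x by auto
  qed
  have inj: "inj_on lab ?D"
  proof (rule inj_onI)
    fix y z assume "y \<in> ?D" "z \<in> ?D" and eq: "lab y = lab z"
    then obtain i j where i: "y = xs ! i" "k \<le> i" "\<forall>m. k \<le> m \<and> m < i \<longrightarrow> lab (xs ! m) \<noteq> lab (xs ! i)"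
      and j: "z = xs ! j" "k \<le> j" "\<forall>m. k \<le> m \<and> m < j \<longrightarrow> lab (xs ! m) \<noteq> lab (xs ! j)"
      unfolding D by blast
    \<comment> \<open>Otherwise the earlier of the two would have caused the later one to be
      rejected.\<close>
    have "\<not> i < j" "\<not> j < i"
      using i j eq by auto
    then show "y = z"
      using i j by simp
  qed
  define M where "M = {(l, r). l \<in> ?D \<and> lab l = Some (r, False)}"
  have ex: "\<exists>r. lab l = Some (r, False)" if l: "l \<in> ?D" for l
  proof -
    have "lab l \<noteq> None"
      using l unfolding D by blast
    then obtain r h where "lab l = Some (r, h)" by auto
    then show ?thesis
      using lab[of l r h] l DLH by auto
  qed
  have "fst ` M = ?D"
    using ex unfolding M_def by force
  moreover have "M \<subseteq> E"
    using lab DLH unfolding M_def nbrs_def by blast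
  moreover have "fst e \<noteq> fst e' \<and> snd e \<noteq> snd e'" if "e \<in> M" "e' \<in> M" "e \<noteq> e'" for e e'
  proof -
    have e: "fst e \<in> ?D" "lab (fst e) = Some (snd e, False)"
      and e': "fst e' \<in> ?D" "lab (fst e') = Some (snd e', False)"
      using that by (auto simp: M_def)
    have "fst e \<noteq> fst e'"
      using e(2) e'(2) that(3) by (auto simp: prod_eq_iff)
    moreover have "snd e \<noteq> snd e'"
      using inj_onD[OF inj, of "fst e" "fst e'"] e e' calculation by auto
    ultimately show ?thesis ..
  qed
  ultimately show ?thesis
    unfolding transversal_indep_def is_matching_def using DLH by blast
qed

text \<open>A lonely node is the only candidate at its right node, so it is the first to arrive
  there in every order and is accepted.\<close>

lemma sampling_rule_value:
  assumes G: "bipartite L R E" and xs: "xs \<in> permutations_of_set L"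
    and f: "nonneg_monotone_submodular L f"
  shows "f {} + g_lonely f {} {} (simulate f (nbrs E) (set (take k xs)) {} {} L)
    \<le> f (run_alg sampling_rule L R E f xs k)"
proof -
  define H where "H = set (take k xs)"
  define es where "es = simulate f (nbrs E) H {} {} L"
  let ?D = "run_alg sampling_rule L R E f xs k"
  have L: "finite L" and x: "distinct xs" "set xs = L"
    using G xs by (auto simp: bipartite_def permutations_of_set_def)
  interpret submodular_secretary L f "nbrs E"
    by unfold_locales (use L f in auto)
  have HL: "H \<subseteq> L"
    using x set_take_subset[of k xs] by (simp add: H_def)
  have DL: "?D \<subseteq> L"
    using sampling_rule_independent[OF G xs] by (auto simp: transversal_indep_def)
  have lab: "label f (nbrs E) H l = map_of es l" if "l \<in> L" for l
    using that label_eq[OF L HL] by (simp add: es_def)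
  have dist: "distinct (map fst es)" and sub: "fst ` set es \<subseteq> L"
    unfolding es_def by (rule distinct_simulate[OF L], rule fst_simulate[OF L])
  have D: "l \<in> ?D" if l: "(l, r, False) \<in> set es"
    and lonely: "\<And>l'. (l', r, False) \<in> set es \<Longrightarrow> l' = l" for l r
  proof -
    have lL: "l \<in> L" "l \<notin> H"
      using simulate_entry[OF L, of l r False] l unfolding es_def by auto
    then obtain j where j: "j < length xs" "l = xs ! j"
      using x by (auto simp: in_set_conv_nth)
    have k: "k \<le> j"
    proof (rule ccontr)
      assume "\<not> k \<le> j"
      then have "xs ! j \<in> set (take k xs)"
        using j by (auto simp: in_set_conv_nth intro!: exI[of _ j])
      then show False using lL j by (simp add: H_def)
    qed
    have some: "map_of es l = Some (r, False)"
      using dist l by (simp add: map_of_is_SomeI)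
    \<comment> \<open>Loneliness forces any node with this label to be \<open>l\<close>, which
      arrives only at position \<open>j\<close>.\<close>
    have "map_of es (xs ! i) \<noteq> Some (r, False)" if "i < j" for i
    proof
      assume "map_of es (xs ! i) = Some (r, False)"
      then have "xs ! i = l"
        using lonely by (auto dest: map_of_SomeD)
      then show False
        using that j x(1) by (simp add: nth_eq_iff_index_eq)
    qed
    moreover have "xs ! i \<in> L" if "i \<le> j" for i
      using that j x by auto
    ultimately show ?thesis
      unfolding run_alg_sampling_rule H_def[symmetric]
      using j k some lab by (auto intro!: exI[of _ j])
  qed
  have "g_lonely f {} {} es \<le> f (?D \<inter> ({} \<union> fst ` set es)) - f (?D \<inter> {})"
  proof (rule g_lonely_le[OF _ sub DL])
    show "l \<in> ?D" if "(l, r, False) \<in> set es" "\<And>l'. (l', r, False) \<in> set es \<Longrightarrow> l' = l" for l r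
      using D that .
  qed simp
  also have "f (?D \<inter> ({} \<union> fst ` set es)) \<le> f ?D"
    using DL by (intro f_mono) auto
  finally show ?thesis
    by (simp add: es_def H_def)
qed

text \<open>The injective partner function \<open>\<tau>\<close> is the form in which
  \<open>greedy_approx\<close> takes a matching.\<close>

lemma opt_value_attained:
  assumes "bipartite L R E"
  obtains T \<tau> where "T \<subseteq> L" "inj_on \<tau> T" "\<And>t. t \<in> T \<Longrightarrow> \<tau> t \<in> nbrs E t" "opt_value L E f = f T"
proof -
  have "finite {T. transversal_indep L E T}"
    using assms by (auto simp: bipartite_def transversal_indep_def)
  moreover have "transversal_indep L E {}"
    unfolding transversal_indep_def is_matching_def by (auto intro!: exI[of _ "{}"])
  ultimately have "opt_value L E f \<in> f ` {T. transversal_indep L E T}"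
    unfolding opt_value_def by (intro Max_in) auto
  then obtain T where T: "transversal_indep L E T" "opt_value L E f = f T"
    by auto
  then obtain M where M: "is_matching E M" "fst ` M = T" "T \<subseteq> L"
    by (auto simp: transversal_indep_def)
  have "\<forall>t\<in>T. \<exists>r. (t, r) \<in> M"
    using M(2) by force
  then obtain \<tau> where \<tau>: "\<And>t. t \<in> T \<Longrightarrow> (t, \<tau> t) \<in> M"
    by metis
  have "inj_on \<tau> T"
  proof (rule inj_onI, rule ccontr)
    fix s t assume "s \<in> T" "t \<in> T" "\<tau> s = \<tau> t" "s \<noteq> t"
    then show False
      using \<tau>[of s] \<tau>[of t] M(1) unfolding is_matching_def by fastforce
  qed
  moreover have "\<tau> t \<in> nbrs E t" if "t \<in> T" for t
    using \<tau>[OF that] M(1) by (auto simp: is_matching_def nbrs_def)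
  ultimately show ?thesis
    using that T(2) M(3) by blast
qed

theorem theorem4:
  "\<exists>(seed :: 'r set \<Rightarrow> nat \<Rightarrow> nat pmf) (A :: ('l, 'r) decision_rule).
     \<forall>(L :: 'l set) (R :: 'r set) E f.
       bipartite L R E \<and> nonneg_monotone_submodular L f \<longrightarrow>
         (\<forall>xs \<in> permutations_of_set L. \<forall>\<omega> \<in> set_pmf (seed R (card L)).
             transversal_indep L E (run_alg A L R E f xs \<omega>)) \<and>
         measure_pmf.expectation (pair_pmf (pmf_of_set (permutations_of_set L)) (seed R (card L)))
             (\<lambda>(xs, \<omega>). f (run_alg A L R E f xs \<omega>))
           \<ge> opt_value L E f / 95"
\<comment> \<open>The seed is the binomial sample length. The value 3/4 is a round number near (3 +
  sqrt 3) / 6, where p (1 - p) (2 p - 1) is largest for p between 1/2 and 1.\<close>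
proof (intro exI[of _ "\<lambda>R n. binomial_pmf n (3 / 4)"] exI[of _ sampling_rule] allI impI conjI ballI)
  fix L :: "'l set" and R :: "'r set" and E f xs \<omega>
  assume "bipartite L R E \<and> nonneg_monotone_submodular L f" "xs \<in> permutations_of_set L"
  then show "transversal_indep L E (run_alg sampling_rule L R E f xs \<omega>)"
    by (intro sampling_rule_independent) auto
next
  fix L :: "'l set" and R :: "'r set" and E f
  assume "bipartite L R E \<and> nonneg_monotone_submodular L f"
  then have G: "bipartite L R E" and f: "nonneg_monotone_submodular L f" by auto
  then have L: "finite L" by (simp add: bipartite_def)
  interpret submodular_secretary L f "nbrs E"
    by unfold_locales (use L f in auto)
  obtain T \<tau> where T: "T \<subseteq> L" "inj_on \<tau> T" "\<And>t. t \<in> T \<Longrightarrow> \<tau> t \<in> nbrs E t"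
    and opt: "opt_value L E f = f T"
    by (rule opt_value_attained[OF G, of f]) blast
  let ?z = "\<lambda>H. g_lonely f {} {} (simulate f (nbrs E) H {} {} L)"
  have "3 / 64 * (f T - f {}) \<le> sample_exp (3 / 4) L ?z"
    using sample_exp_g_lonely_ge[of "3 / 4" T \<tau>] T by simp
  moreover have "0 \<le> f {}" "f {} \<le> f T"
    using f_nonneg[of "{}"] f_mono[of "{}" T] T by auto
  \<comment> \<open>\<open>1 / 95 < 3 / 64\<close>, and the summand \<open>f {}\<close> makes up for
    the one subtracted.\<close>
  ultimately have "opt_value L E f / 95 \<le> f {} + sample_exp (3 / 4) L ?z"
    unfolding opt by simp
  also have "\<dots> = sample_exp (3 / 4) L (\<lambda>H. f {} + ?z H)"
    by (simp add: sample_exp_add sample_exp_const[OF L])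
  also have "\<dots> \<le> measure_pmf.expectation
      (pair_pmf (pmf_of_set (permutations_of_set L)) (binomial_pmf (card L) (3 / 4)))
      (\<lambda>(xs, \<omega>). f (run_alg sampling_rule L R E f xs \<omega>))"
    using sampling_rule_value[OF G _ f] by (intro expectation_binomial_prefix[OF L]) auto
  finally show "opt_value L E f / 95 \<le> measure_pmf.expectation
      (pair_pmf (pmf_of_set (permutations_of_set L)) (binomial_pmf (card L) (3 / 4)))
      (\<lambda>(xs, \<omega>). f (run_alg sampling_rule L R E f xs \<omega>))" .
qed

end
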